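(* Let $A\in\mathbb{R}^{m\times m}$, $D\in\mathbb{R}^{n\times n}$, $B\in\mathbb{R}^{m\times n}$, $C\in\mathbb{R}^{n\times m}$, where $B$ and $C$ have full rank factorizations $B=B_lB_r^{\mathsf T}$ and $C=C_lC_r^{\mathsf T}$ with $B_l\in\mathbb{R}^{m\times m_1}$, $B_r\in\mathbb{R}^{n\times m_1}$, $C_l\in\mathbb{R}^{n\times n_1}$, $C_r\in\mathbb{R}^{m\times n_1}$. Let $\gamma\ge\max_{i,j}\{a_{ii},d_{jj}\}$, where $a_{ii}$ and $d_{jj}$ are the diagonal entries of $A$ and $D$, and suppose that the matrices $$A_\gamma:=A+\gamma I_m,\quad D_\gamma:=D+\gamma I_n,\quad W_\gamma:=A_\gamma-BD_\gamma^{-1}C,\quad V_\gamma:=D_\gamma-CA_\gamma^{-1}B$$ are nonsingular. Set $$F_0=I_m-2\gamma W_\gamma^{-1},\quad E_0=I_n-2\gamma V_\gamma^{-1},\quad H_0=2\gamma W_\gamma^{-1}BD_\gamma^{-1},\quad G_0=2\gamma D_\gamma^{-1}CW_\gamma^{-1},$$ and, for $k\ge0$, let the iterates of the structure-preserving doubling algorithm (SDA) be defined by $$F_{k+1}=F_k(I_m-H_kG_k)^{-1}F_k,\qquad E_{k+1}=E_k(I_n-G_kH_k)^{-1}E_k,$$ $$H_{k+1}=H_k+F_k(I_m-H_kG_k)^{-1}H_kE_k,\qquad G_{k+1}=G_k+E_k(I_n-G_kH_k)^{-1}G_kF_k,$$ where it is assumed that $I_m-H_kG_k$ and $I_n-G_kH_k$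 are nonsingular for all $k\ge0$. Let $\widetilde A_\gamma:=I_m-2\gamma A_\gamma^{-1}$, $\widetilde D_\gamma:=I_n-2\gamma D_\gamma^{-1}$, and define $$U_0:=A_\gamma^{-1}B_l,\quad V_0:=A_\gamma^{-\mathsf T}C_r,\quad W_0:=D_\gamma^{-1}C_l,\quad Q_0:=D_\gamma^{-\mathsf T}B_r,$$ $$Y_0:=B_r^{\mathsf T}D_\gamma^{-1}C_l,\quad Z_0:=C_r^{\mathsf T}A_\gamma^{-1}B_l,\quad T_0:=Q_0^{\mathsf T}W_0,\quad S_0:=V_0^{\mathsf T}U_0.$$ For $j\ge1$ let $U_j:=\widetilde A_\gamma U_{j-1}$, $V_j:=\widetilde A_\gamma^{\mathsf T}V_{j-1}$, $W_j:=\widetilde D_\gamma W_{j-1}$, $Q_j:=\widetilde D_\gamma^{\mathsf T}Q_{j-1}$, $$\widehat U_j:=[U_0,\ldots,U_{2^j-1}],\quad \widehat V_j:=[V_0,\ldots,V_{2^j-1}],\quad \widehat W_j:=[W_0,\ldots,W_{2^j-1}],\quad \widehat Q_j:=[Q_0,\ldots,Q_{2^j-1}],$$ $$T_j:=\widehat Q_j^{\mathsf T}\widehat W_j,\quad S_j:=\widehat V_j^{\mathsf T}\widehat U_j,\quad Y_j:=\begin{bmatrix} 0 & Y_{j-1} \\ Y_{j-1} & -2\gamma T_{j-1} \end{bmatrix},\quad Z_j:=\begin{bmatrix} 0 & Z_{j-1} \\ Z_{j-1} & -2\gamma S_{j-1} \end{bmatrix}.$$ Then for all $k\ge1$, $$F_k=\widetilde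 A_\gamma^{2^k}-2\gamma\,\widehat U_k(I_{2^km_1}-Y_kZ_k)^{-1}Y_k\widehat V_k^{\mathsf T},\qquad E_k=\widetilde D_\gamma^{2^k}-2\gamma\,\widehat W_k(I_{2^kn_1}-Z_kY_k)^{-1}Z_k\widehat Q_k^{\mathsf T},$$ $$H_k=2\gamma\,\widehat U_k(I_{2^km_1}-Y_kZ_k)^{-1}\widehat Q_k^{\mathsf T},\qquad G_k=2\gamma\,\widehat W_k(I_{2^kn_1}-Z_kY_k)^{-1}\widehat V_k^{\mathsf T}.$$
   Context: $I_p$ is the $p\times p$ identity matrix, $M^{\mathsf T}$ is the transpose of $M$, and $M^{-\mathsf T}=(M^{-1})^{\mathsf T}$. $[U_0,\ldots,U_q]$ denotes the block row matrix obtained by concatenating columns. A full rank factorization $B=B_lB_r^{\mathsf T}$ is one in which $B_l$ and $B_r$ have full column rank. An inverse sign indicates invertibility. The matrices $W_\gamma,V_\gamma$ (subscript $\gamma$) are distinct from the sequences $W_j,V_j$ (integer subscript). The SDA with these starting values is the iteration used to solve the M-matrix algebraic Riccati equation $XCX-XD-AX+B=0$. *)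

theory Defs
  imports
    "Jordan_Normal_Form.Gauss_Jordan_Elimination"
    "Jordan_Normal_Form.DL_Rank"
begin

(* Total version of mat_inverse; it is unspecified on matrices that are not invertible. *)
definition mat_inv :: "'a :: field mat \<Rightarrow> 'a mat" where
  "mat_inv M = the (mat_inverse M)"

definition full_column_rank :: "'a :: field mat \<Rightarrow> bool" where
  "full_column_rank M \<longleftrightarrow> vec_space.rank (dim_row M) M = dim_col M"

definition full_rank_factorization :: "'a :: field mat \<Rightarrow> 'a mat \<Rightarrow> 'a mat \<Rightarrow> bool" where
  "full_rank_factorization M L R \<longleftrightarrow>
     M = L * R\<^sup>T \<and> full_column_rank L \<and> full_column_rank R"

definition append_cols :: "'a :: zero mat \<Rightarrow> 'a mat \<Rightarrow> 'a mat" where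
  "append_cols M N = four_block_mat M N (0\<^sub>m 0 (dim_col M)) (0\<^sub>m 0 (dim_col N))"

(* block_row X p is the block row [X 0, ..., X (p - 1)]. *)
primrec block_row :: "(nat \<Rightarrow> 'a :: zero mat) \<Rightarrow> nat \<Rightarrow> 'a mat" where
  "block_row X 0 = 0\<^sub>m (dim_row (X 0)) 0"
| "block_row X (Suc p) = append_cols (block_row X p) (X p)"

end

theory Submission
  imports Defs
begin

text \<open>
  Read the \<open>k\<close>-th SDA iterate as a scattering map \<open>(u, y) \<mapsto> (F u + H y, E y + G u)\<close>.
  The claimed closed forms say that this map is computed by the implicit system
  \<open>a + Y b = c Q\<^sup>T y\<close>, \<open>b + Z a = c V\<^sup>T u\<close> with outputs \<open>P u + U a\<close> and \<open>P' y + W b\<close>, where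
  \<open>c = 2 \<gamma>\<close>, \<open>P = At ^ 2 ^ k\<close> and \<open>P' = Dt ^ 2 ^ k\<close>. An SDA step connects two copies of the
  map in series, and the same connection of two implicit systems, with the internal variables
  stacked in opposite orders as \<open>(a1, a0)\<close> and \<open>(b0, b1)\<close>, is the implicit system with the
  doubled \<open>U, V, W, Q, Y, Z\<close>. A kernel vector of \<open>I - Y Z\<close> is a solution of the homogeneous
  system, so the invertibility of the doubled matrix follows from that of \<open>I - H G\<close>.
\<close>

section \<open>Matrix-vector algebra and matrix inverses\<close>

text \<open>The premises are equations between dimensions, which simp discharges by itself. As a
  rewrite set the rules turn a matrix expression applied to a vector into nested applications of
  single matrices.\<close>

lemma mult_mat_vec_distribs:
  fixes A B :: "'a :: field mat"
  shows mult_mult_mat_vec: "dim_col A = dim_row B \<Longrightarrow> dim_vec v = dim_col B \<Longrightarrow> (A * B) *\<^sub>v v = A *\<^sub>v (B *\<^sub>v v)"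
    and add_mult_mat_vec: "dim_row A = dim_row B \<Longrightarrow> dim_col A = dim_col B \<Longrightarrow> dim_vec v = dim_col B \<Longrightarrow>
      (A + B) *\<^sub>v v = A *\<^sub>v v + B *\<^sub>v v"
    and minus_mult_mat_vec: "dim_row A = dim_row B \<Longrightarrow> dim_col A = dim_col B \<Longrightarrow> dim_vec v = dim_col B \<Longrightarrow>
      (A - B) *\<^sub>v v = A *\<^sub>v v - B *\<^sub>v v"
    and smult_mult_mat_vec: "dim_vec v = dim_col A \<Longrightarrow> (k \<cdot>\<^sub>m A) *\<^sub>v v = k \<cdot>\<^sub>v (A *\<^sub>v v)"
    and mult_mat_vec_add: "dim_vec v = dim_col A \<Longrightarrow> dim_vec w = dim_col A \<Longrightarrow>
      A *\<^sub>v (v + w) = A *\<^sub>v v + A *\<^sub>v w"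
    and mult_mat_vec_minus: "dim_vec v = dim_col A \<Longrightarrow> dim_vec w = dim_col A \<Longrightarrow>
      A *\<^sub>v (v - w) = A *\<^sub>v v - A *\<^sub>v w"
    and mult_mat_vec_smult: "dim_vec v = dim_col A \<Longrightarrow> A *\<^sub>v (k \<cdot>\<^sub>v v) = k \<cdot>\<^sub>v (A *\<^sub>v v)"
    and mult_mat_vec_zero: "dim_col A = d \<Longrightarrow> A *\<^sub>v 0\<^sub>v d = 0\<^sub>v (dim_row A)"
    and one_mult_mat_vec: "dim_vec v = d \<Longrightarrow> 1\<^sub>m d *\<^sub>v v = v"
    and smult_vec_zero: "k \<cdot>\<^sub>v 0\<^sub>v d = (0\<^sub>v d :: 'a vec)"
    and zero_mult_mat_vec: "dim_vec v = d \<Longrightarrow> 0\<^sub>m e d *\<^sub>v v = 0\<^sub>v e"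
proof -
  show "dim_col A = dim_row B \<Longrightarrow> dim_vec v = dim_col B \<Longrightarrow> (A * B) *\<^sub>v v = A *\<^sub>v (B *\<^sub>v v)"
    by (rule assoc_mult_mat_vec) (auto intro: carrier_vecI)
  show "dim_row A = dim_row B \<Longrightarrow> dim_col A = dim_col B \<Longrightarrow> dim_vec v = dim_col B \<Longrightarrow>
      (A + B) *\<^sub>v v = A *\<^sub>v v + B *\<^sub>v v"
    by (rule add_mult_distrib_mat_vec) (auto intro: carrier_vecI)
  show "dim_row A = dim_row B \<Longrightarrow> dim_col A = dim_col B \<Longrightarrow> dim_vec v = dim_col B \<Longrightarrow>
      (A - B) *\<^sub>v v = A *\<^sub>v v - B *\<^sub>v v"
    by (rule minus_mult_distrib_mat_vec) (auto intro: carrier_vecI)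
  show "dim_vec v = dim_col A \<Longrightarrow> (k \<cdot>\<^sub>m A) *\<^sub>v v = k \<cdot>\<^sub>v (A *\<^sub>v v)"
    by (intro eq_vecI) auto
  show "dim_vec v = dim_col A \<Longrightarrow> dim_vec w = dim_col A \<Longrightarrow>
      A *\<^sub>v (v + w) = A *\<^sub>v v + A *\<^sub>v w"
    by (rule mult_add_distrib_mat_vec) (auto intro: carrier_vecI)
  show "dim_vec v = dim_col A \<Longrightarrow> dim_vec w = dim_col A \<Longrightarrow>
      A *\<^sub>v (v - w) = A *\<^sub>v v - A *\<^sub>v w"
    by (rule mult_minus_distrib_mat_vec) (auto intro: carrier_vecI)
  show "dim_vec v = dim_col A \<Longrightarrow> A *\<^sub>v (k \<cdot>\<^sub>v v) = k \<cdot>\<^sub>v (A *\<^sub>v v)"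
    by (rule mult_mat_vec) (auto intro: carrier_vecI)
  show "dim_col A = d \<Longrightarrow> A *\<^sub>v 0\<^sub>v d = 0\<^sub>v (dim_row A)"
    by (intro eq_vecI) auto
  show "dim_vec v = d \<Longrightarrow> 1\<^sub>m d *\<^sub>v v = v"
    by (rule one_mult_mat_vec) (auto intro: carrier_vecI)
  show "k \<cdot>\<^sub>v 0\<^sub>v d = (0\<^sub>v d :: 'a vec)"
    by (intro eq_vecI) auto
  show "dim_vec v = d \<Longrightarrow> 0\<^sub>m e d *\<^sub>v v = 0\<^sub>v e"
    by (intro eq_vecI) auto
qed

lemma transpose_mult_dims:
  fixes A B :: "'a :: comm_semiring_0 mat"
  shows "dim_col A = dim_row B \<Longrightarrow> (A * B)\<^sup>T = B\<^sup>T * A\<^sup>T"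
  by (rule transpose_mult) auto

lemma mat_eqI_mult_vec:
  fixes M N :: "'a :: field mat"
  assumes M: "M \<in> carrier_mat r s" and N: "N \<in> carrier_mat r s"
    and eq: "\<And>v. v \<in> carrier_vec s \<Longrightarrow> M *\<^sub>v v = N *\<^sub>v v"
  shows "M = N"
proof (rule eq_matI)
  fix i j assume "i < dim_row N" "j < dim_col N"
  then have ij: "i < r" "j < s" using N by auto
  have "(M *\<^sub>v unit_vec s j) $ i = (N *\<^sub>v unit_vec s j) $ i"
    by (simp add: eq)
  then show "M $$ (i, j) = N $$ (i, j)" using ij M N by simp
qed (use M N in auto)

text \<open>A trivial kernel forces a nonzero determinant, which makes the matrix a unit of the
  matrix ring. Thus no inverse of a block matrix ever has to be written down.\<close>

lemma invertible_matI_inj: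
  fixes M :: "'a :: field mat"
  assumes M: "M \<in> carrier_mat s s"
    and inj: "\<And>v. v \<in> carrier_vec s \<Longrightarrow> M *\<^sub>v v = 0\<^sub>v s \<Longrightarrow> v = 0\<^sub>v s"
  shows "invertible_mat M"
proof -
  have "det M \<noteq> 0" using inj det_0_iff_vec_prod_zero[OF M] by blast
  then show ?thesis
    using det_non_zero_imp_unit[OF M, where b = "()"] M
    unfolding Units_def ring_mat_def invertible_mat_def inverts_mat_def by auto
qed

lemma mat_inv:
  fixes M :: "'a :: field mat"
  assumes M: "M \<in> carrier_mat s s" and inv: "invertible_mat M"
  shows mat_inv_carrier: "mat_inv M \<in> carrier_mat s s"
    and mat_inv_right: "M * mat_inv M = 1\<^sub>m s"
    and mat_inv_left: "mat_inv M * M = 1\<^sub>m s"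
proof -
  obtain N where N: "M * N = 1\<^sub>m (dim_row M)" "N * M = 1\<^sub>m (dim_row N)"
    using inv unfolding invertible_mat_def inverts_mat_def by auto
  \<comment> \<open>\<open>inverts_mat\<close> prescribes no shape for \<open>N\<close>; counting
    columns on both sides of the two identities shows that it is square of size
    \<open>s\<close>.\<close>
  have "dim_col (M * N) = s" using N(1) M by simp
  moreover have "dim_col (N * M) = dim_row N" using N(2) by simp
  ultimately have Nc: "N \<in> carrier_mat s s" using M by auto
  then have "M \<in> Units (ring_mat TYPE('a) s ())"
    using N M unfolding Units_def ring_mat_def by auto
  then obtain K where "mat_inverse M = Some K"
    using mat_inverse(1)[OF M, where b = "()"] by (cases "mat_inverse M") auto
  then show "mat_inv M \<in> carrier_mat s s" "M * mat_inv M = 1\<^sub>m s" "mat_inv M * M = 1\<^sub>m s"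
    using mat_inverse(2)[OF M] by (auto simp: mat_inv_def)
qed

lemma mat_inv_mult_vec:
  fixes M :: "'a :: field mat"
  assumes "M \<in> carrier_mat s s" and "invertible_mat M" and "v \<in> carrier_vec s"
  shows mult_mat_inv_vec: "M *\<^sub>v (mat_inv M *\<^sub>v v) = v"
    and mat_inv_mult_vec_cancel: "mat_inv M *\<^sub>v (M *\<^sub>v v) = v"
proof -
  note [simp] = mat_inv[OF assms(1,2)]
  show "M *\<^sub>v (mat_inv M *\<^sub>v v) = v"
    using assms by (subst assoc_mult_mat_vec[of _ s s _ s, symmetric]) auto
  show "mat_inv M *\<^sub>v (M *\<^sub>v v) = v"
    using assms by (subst assoc_mult_mat_vec[of _ s s _ s, symmetric]) auto
qed

section \<open>Block rows and their doubling\<close>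

lemma append_cols_carrier:
  "M \<in> carrier_mat r s \<Longrightarrow> N \<in> carrier_mat r t \<Longrightarrow> append_cols M N \<in> carrier_mat r (s + t)"
  by (auto simp: append_cols_def)

lemma append_cols_mult_vec:
  fixes M N :: "'a :: field mat"
  assumes "M \<in> carrier_mat r s" "N \<in> carrier_mat r t" "a \<in> carrier_vec s" "b \<in> carrier_vec t"
  shows "append_cols M N *\<^sub>v (a @\<^sub>v b) = M *\<^sub>v a + N *\<^sub>v b"
proof -
  have "append_cols M N *\<^sub>v (a @\<^sub>v b) =
      (M *\<^sub>v a + N *\<^sub>v b) @\<^sub>v (0\<^sub>m 0 s *\<^sub>v a + 0\<^sub>m 0 t *\<^sub>v b)"
    using assms unfolding append_cols_def by (subst four_block_mat_mult_vec) auto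
  then show ?thesis using assms by (intro eq_vecI) (auto simp del: index_mult_mat_vec)
qed

lemma append_cols_transpose_mult_vec:
  fixes M N :: "'a :: field mat"
  assumes "M \<in> carrier_mat r s" "N \<in> carrier_mat r t" "u \<in> carrier_vec r"
  shows "(append_cols M N)\<^sup>T *\<^sub>v u = (M\<^sup>T *\<^sub>v u) @\<^sub>v (N\<^sup>T *\<^sub>v u)"
proof (rule eq_vecI)
  fix i assume "i < dim_vec ((M\<^sup>T *\<^sub>v u) @\<^sub>v (N\<^sup>T *\<^sub>v u))"
  then have i: "i < s + t" using assms by auto
  have "col (append_cols M N) i = (if i < s then col M i else col N (i - s))"
    using assms i by (intro eq_vecI) (auto simp: append_cols_def)
  then show "((append_cols M N)\<^sup>T *\<^sub>v u) $ i = ((M\<^sup>T *\<^sub>v u) @\<^sub>v (N\<^sup>T *\<^sub>v u)) $ i"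
    using i assms append_cols_carrier[OF assms(1,2)] by auto
qed (use assms append_cols_carrier[OF assms(1,2)] in auto)

lemma block_row_carrier:
  assumes "\<And>i. X i \<in> carrier_mat r w"
  shows "block_row X p \<in> carrier_mat r (p * w)"
  using assms carrier_matD[OF assms]
  by (induction p) (auto simp: append_cols_def)

text \<open>The recursion of \<open>block_row\<close> exposes only the last block; an entry formula
  makes it possible to cut the row in the middle, as doubling requires.\<close>

lemma block_row_index:
  assumes X: "\<And>i. X i \<in> carrier_mat r w" and "i < r" "j < p * w"
  shows "block_row X p $$ (i, j) = X (j div w) $$ (i, j mod w)"
  using assms(2,3)
proof (induction p)
  case (Suc p)
  have dims: "dim_row (block_row X p) = r" "dim_col (block_row X p) = p * w"
    using block_row_carrier[of X r w p, OF X] by auto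
  show ?case
  proof (cases "j < p * w")
    case True
    then show ?thesis using Suc dims carrier_matD[OF X] by (simp add: append_cols_def)
  next
    case False
    then have "j div w = p"
      using Suc.prems by (intro div_nat_eqI) (auto simp: mult.commute)
    moreover from this have "j mod w = j - p * w" by (metis minus_div_mult_eq_mod)
    ultimately show ?thesis using Suc.prems False dims carrier_matD[OF X] by (simp add: append_cols_def)
  qed
qed simp

text \<open>Multiplication by \<open>P\<close> acts on each column separately, so
  \<open>P * block_row X p\<close> consists of the blocks \<open>P * X i\<close>, which by
  \<open>shift\<close> are the blocks \<open>p\<close> to \<open>2 * p - 1\<close>.\<close>

lemma block_row_double:
  fixes X :: "nat \<Rightarrow> 'a :: field mat"
  assumes X: "\<And>i. X i \<in> carrier_mat r w" and P: "P \<in> carrier_mat r r"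
    and shift: "\<And>i. X (p + i) = P * X i"
  shows "block_row X (2 * p) = append_cols (block_row X p) (P * block_row X p)"
proof (rule eq_matI)
  note br = block_row_carrier[of X r w, OF X]
  note brD = carrier_matD[OF br]
  have ac: "append_cols (block_row X p) (P * block_row X p) \<in> carrier_mat r (p * w + p * w)"
    using br[of p] P by (intro append_cols_carrier) auto
  then show "dim_row (block_row X (2 * p)) = dim_row (append_cols (block_row X p) (P * block_row X p))"
    "dim_col (block_row X (2 * p)) = dim_col (append_cols (block_row X p) (P * block_row X p))"
    using brD[of "2 * p"] by auto
  fix i j assume "i < dim_row (append_cols (block_row X p) (P * block_row X p))"
    "j < dim_col (append_cols (block_row X p) (P * block_row X p))"
  then have i: "i < r" and j: "j < p * w + p * w" using ac by auto
  \<comment> \<open>The existence of a column \<open>j\<close> forces \<open>w > 0\<close>, so that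
    \<open>div\<close> and \<open>mod\<close> by \<open>w\<close> locate its block.\<close>
  then have w: "w > 0" by (cases w) auto
  show "block_row X (2 * p) $$ (i, j) = append_cols (block_row X p) (P * block_row X p) $$ (i, j)"
  proof (cases "j < p * w")
    case True
    then show ?thesis using i j brD P block_row_index[of X r w, OF X]
      by (auto simp: append_cols_def)
  next
    case False
    define l where "l = j - p * w"
    have l: "l < p * w" "j = l + p * w" using False j by (auto simp: l_def)
    have "col (block_row X p) l = col (X (l div w)) (l mod w)"
      using brD carrier_matD[OF X] l w block_row_index[of X r w, OF X]
      by (intro eq_vecI) auto
    moreover have "block_row X (2 * p) $$ (i, j) = X (p + l div w) $$ (i, l mod w)"
      using i j w l(2) by (subst block_row_index[of X r w, OF X]) (auto simp: add.commute)
    ultimately show ?thesis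
      using i j l w brD P carrier_matD[OF X] shift
      by (auto simp: append_cols_def)
  qed
qed

section \<open>Powers of a square matrix\<close>

lemma pow_mat_carrier: "P \<in> carrier_mat r r \<Longrightarrow> P ^\<^sub>m k \<in> carrier_mat r r"
  by (induction k) auto

lemma pow_mat_add:
  fixes P :: "'a :: field mat"
  assumes P: "P \<in> carrier_mat r r"
  shows "P ^\<^sub>m (k + l) = P ^\<^sub>m k * P ^\<^sub>m l"
proof (induction l)
  case (Suc l)
  have "P ^\<^sub>m k * P ^\<^sub>m l * P = P ^\<^sub>m k * (P ^\<^sub>m l * P)"
    using pow_mat_carrier[OF P] P by (intro assoc_mult_mat)
  then show ?case using Suc by simp
qed (use P pow_mat_carrier[OF P, of k] in simp)

lemma pow_mat_shift:
  fixes P :: "'a :: field mat"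
  assumes P: "P \<in> carrier_mat r r" and X: "\<And>i. X i \<in> carrier_mat r w"
    and rec: "\<And>i. X (Suc i) = P * X i"
  shows "X (p + i) = P ^\<^sub>m p * X i"
proof (induction p arbitrary: i)
  case 0
  then show ?case using X[of i] P by simp
next
  case (Suc p)
  have "X (p + Suc i) = P ^\<^sub>m p * (P * X i)" using Suc.IH rec by metis
  then show ?case using pow_mat_carrier[OF P] P X
    by (simp add: assoc_mult_mat[of _ r r _ r _ w])
qed

lemma transpose_pow_mat:
  fixes P :: "'a :: field mat"
  assumes P: "P \<in> carrier_mat r r"
  shows "(P\<^sup>T) ^\<^sub>m k = (P ^\<^sub>m k)\<^sup>T"
proof (induction k)
  case 0
  then show ?case using P by simp
next
  case (Suc k)
  \<comment> \<open>\<open>^\<^sub>m\<close> adds its factors on the right and transposition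
    reverses the order, so a factor must be peeled off on the left; the exponent
    \<open>1 + k\<close> does this.\<close>
  have "P\<^sup>T ^\<^sub>m Suc k = P\<^sup>T ^\<^sub>m (1 + k)" by simp
  also have "\<dots> = P\<^sup>T * P\<^sup>T ^\<^sub>m k"
    using P pow_mat_add[of "P\<^sup>T" r 1 k] by simp
  also have "\<dots> = (P ^\<^sub>m Suc k)\<^sup>T"
    using Suc P pow_mat_carrier[OF P, of k] by (simp add: transpose_mult[of _ r r _ r])
  finally show ?case .
qed

section \<open>One stage as an implicit system, and its doubling\<close>

text \<open>Invariant of the induction. It describes the iterates by what every solution
  \<open>(a, b)\<close> of the implicit system outputs, so no inverse of
  \<open>1\<^sub>m p - Y * Z\<close> occurs in it; nonsingularity enters as the absence of nonzero
  fixed vectors of \<open>Y * Z\<close>. In this form two stages are connected by stacking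
  vectors.\<close>

locale sda_stage =
  fixes m n p q :: nat and c :: "'a :: field"
    and P P' U V W Q Y Z F E H G :: "'a mat"
  assumes carrier: "P \<in> carrier_mat m m" "P' \<in> carrier_mat n n"
      "U \<in> carrier_mat m p" "V \<in> carrier_mat m q" "W \<in> carrier_mat n q" "Q \<in> carrier_mat n p"
      "Y \<in> carrier_mat p q" "Z \<in> carrier_mat q p"
      "F \<in> carrier_mat m m" "E \<in> carrier_mat n n" "H \<in> carrier_mat m n" "G \<in> carrier_mat n m"
    and YZ_fixed: "\<And>a. a \<in> carrier_vec p \<Longrightarrow> Y *\<^sub>v (Z *\<^sub>v a) = a \<Longrightarrow> a = 0\<^sub>v p"
    and transfer_F: "\<And>u y a b. u \<in> carrier_vec m \<Longrightarrow> y \<in> carrier_vec n \<Longrightarrow>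
        a \<in> carrier_vec p \<Longrightarrow> b \<in> carrier_vec q \<Longrightarrow>
        a + Y *\<^sub>v b = c \<cdot>\<^sub>v (Q\<^sup>T *\<^sub>v y) \<Longrightarrow> b + Z *\<^sub>v a = c \<cdot>\<^sub>v (V\<^sup>T *\<^sub>v u) \<Longrightarrow>
        P *\<^sub>v u + U *\<^sub>v a = F *\<^sub>v u + H *\<^sub>v y"
    and transfer_E: "\<And>u y a b. u \<in> carrier_vec m \<Longrightarrow> y \<in> carrier_vec n \<Longrightarrow>
        a \<in> carrier_vec p \<Longrightarrow> b \<in> carrier_vec q \<Longrightarrow>
        a + Y *\<^sub>v b = c \<cdot>\<^sub>v (Q\<^sup>T *\<^sub>v y) \<Longrightarrow> b + Z *\<^sub>v a = c \<cdot>\<^sub>v (V\<^sup>T *\<^sub>v u) \<Longrightarrow>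
        P' *\<^sub>v y + W *\<^sub>v b = E *\<^sub>v y + G *\<^sub>v u"
begin

lemmas dims [simp] = carrier[THEN carrier_matD(1)] carrier[THEN carrier_matD(2)]
lemmas mv = mult_mat_vec_distribs

text \<open>The implicit system is symmetric in its two halves, so facts about \<open>F\<close> and
  \<open>H\<close> yield those about \<open>E\<close> and \<open>G\<close>. For the fixed vectors:
  if \<open>Z Y b = b\<close>, then \<open>Y b\<close> is fixed by \<open>Y Z\<close>, hence zero,
  and so is \<open>b = Z (Y b)\<close>.\<close>

lemma dual: "sda_stage n m q p c P' P W Q U V Z Y E F G H"
proof
  fix b :: "'a vec" assume b: "b \<in> carrier_vec q" "Z *\<^sub>v (Y *\<^sub>v b) = b"
  have "Y *\<^sub>v b = 0\<^sub>v p" using b carrier by (intro YZ_fixed) auto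
  then show "b = 0\<^sub>v q" using b(2) mult_mat_vec_zero[of Z p] dims by metis
next
  fix u y a b
  assume "u \<in> carrier_vec n" "y \<in> carrier_vec m" "a \<in> carrier_vec q" "b \<in> carrier_vec p"
    and "a + Z *\<^sub>v b = c \<cdot>\<^sub>v (V\<^sup>T *\<^sub>v y)" "b + Y *\<^sub>v a = c \<cdot>\<^sub>v (Q\<^sup>T *\<^sub>v u)"
  then show "P' *\<^sub>v u + W *\<^sub>v a = E *\<^sub>v u + G *\<^sub>v y" "P *\<^sub>v y + U *\<^sub>v b = F *\<^sub>v y + H *\<^sub>v u"
    using transfer_E transfer_F by blast+
qed (fact carrier)+

lemma invertible_YZ: "invertible_mat (1\<^sub>m p - Y * Z)"
proof (rule invertible_matI_inj)
  show "1\<^sub>m p - Y * Z \<in> carrier_mat p p"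
    by (rule carrier_matI) simp_all
  fix a assume a: "a \<in> carrier_vec p" and ker: "(1\<^sub>m p - Y * Z) *\<^sub>v a = 0\<^sub>v p"
  have [simp]: "dim_vec a = p" using a by auto
  have eq: "a - Y *\<^sub>v (Z *\<^sub>v a) = 0\<^sub>v p" using ker by (simp add: mv)
  have "Y *\<^sub>v (Z *\<^sub>v a) = a"
  proof (rule eq_vecI)
    fix i assume "i < dim_vec a"
    then show "(Y *\<^sub>v (Z *\<^sub>v a)) $ i = a $ i"
      using arg_cong[OF eq, of "\<lambda>v. v $ i"] by (simp del: index_mult_mat_vec)
  qed simp
  then show "a = 0\<^sub>v p" by (rule YZ_fixed[OF a])
qed

text \<open>The inputs \<open>(u, 0)\<close> and \<open>(0, y)\<close> isolate \<open>F\<close> and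
  \<open>H\<close>: a solution of the implicit system is written down with the inverse, and
  \<open>transfer_F\<close> reads off the matrix.\<close>

lemma closed_forms:
  shows "F = P - c \<cdot>\<^sub>m (U * mat_inv (1\<^sub>m p - Y * Z) * Y * V\<^sup>T)"
    and "H = c \<cdot>\<^sub>m (U * mat_inv (1\<^sub>m p - Y * Z) * Q\<^sup>T)"
proof -
  have N: "1\<^sub>m p - Y * Z \<in> carrier_mat p p" by (rule carrier_matI) simp_all
  define R where "R = mat_inv (1\<^sub>m p - Y * Z)"
  have R: "R \<in> carrier_mat p p" unfolding R_def by (rule mat_inv_carrier[OF N invertible_YZ])
  note [simp] = carrier_matD[OF R] R_def[symmetric]
  \<comment> \<open>The identity \<open>(1\<^sub>m p - Y * Z) * R = 1\<^sub>m p\<close>, solved for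
    the \<open>Y Z\<close> term so that simp can check the solutions with it.\<close>
  have YZR: "Y *\<^sub>v (Z *\<^sub>v (R *\<^sub>v w)) = R *\<^sub>v w - w" if w: "w \<in> carrier_vec p" for w
  proof (rule eq_vecI)
    have [simp]: "dim_vec w = p" using w by auto
    have eq: "R *\<^sub>v w - Y *\<^sub>v (Z *\<^sub>v (R *\<^sub>v w)) = w"
      using mult_mat_inv_vec[OF N invertible_YZ w] by (simp add: mv)
    fix i assume "i < dim_vec (R *\<^sub>v w - w)"
    then show "(Y *\<^sub>v (Z *\<^sub>v (R *\<^sub>v w))) $ i = (R *\<^sub>v w - w) $ i"
      using arg_cong[OF eq, of "\<lambda>v. v $ i"] by (simp add: diff_eq_eq eq_diff_eq del: index_mult_mat_vec)
  qed (use w in simp)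
  show "F = P - c \<cdot>\<^sub>m (U * R * Y * V\<^sup>T)"
  proof (rule mat_eqI_mult_vec)
    show "F \<in> carrier_mat m m" "P - c \<cdot>\<^sub>m (U * R * Y * V\<^sup>T) \<in> carrier_mat m m"
      by (rule carrier_matI; simp)+
    fix u :: "'a vec" assume u: "u \<in> carrier_vec m"
    then have [simp]: "dim_vec u = m" by auto
    define w where "w = Y *\<^sub>v (V\<^sup>T *\<^sub>v u)"
    have w: "w \<in> carrier_vec p" by (rule carrier_vecI) (simp add: w_def)
    then have [simp]: "dim_vec w = p" by auto
    \<comment> \<open>For \<open>y = 0\<close> the second equation gives
      \<open>b = c V\<^sup>T u - Z a\<close>; inserted into the first one it leaves
      \<open>(I - Y Z) a = - c w\<close>.\<close>
    let ?a = "(- c) \<cdot>\<^sub>v (R *\<^sub>v w)"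
    let ?b = "c \<cdot>\<^sub>v (V\<^sup>T *\<^sub>v u) - Z *\<^sub>v ?a"
    have eq: "P *\<^sub>v u + U *\<^sub>v ?a = F *\<^sub>v u + H *\<^sub>v 0\<^sub>v n"
    proof (rule transfer_F[OF u])
      show "?a \<in> carrier_vec p" "?b \<in> carrier_vec q" "0\<^sub>v n \<in> carrier_vec n"
        by (rule carrier_vecI; simp)+
      show "?a + Y *\<^sub>v ?b = c \<cdot>\<^sub>v (Q\<^sup>T *\<^sub>v 0\<^sub>v n)"
        by (rule eq_vecI)
          (simp_all add: mv YZR[OF w] w_def[symmetric] right_diff_distrib del: index_mult_mat_vec)
      show "?b + Z *\<^sub>v ?a = c \<cdot>\<^sub>v (V\<^sup>T *\<^sub>v u)"
        by (rule eq_vecI) (simp_all del: index_mult_mat_vec)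
    qed
    show "F *\<^sub>v u = (P - c \<cdot>\<^sub>m (U * R * Y * V\<^sup>T)) *\<^sub>v u"
    proof (rule eq_vecI)
      fix i assume "i < dim_vec ((P - c \<cdot>\<^sub>m (U * R * Y * V\<^sup>T)) *\<^sub>v u)"
      then show "(F *\<^sub>v u) $ i = ((P - c \<cdot>\<^sub>m (U * R * Y * V\<^sup>T)) *\<^sub>v u) $ i"
        using arg_cong[OF eq, of "\<lambda>v. v $ i"]
        by (simp add: mv w_def del: index_mult_mat_vec)
    qed simp
  qed
  show "H = c \<cdot>\<^sub>m (U * R * Q\<^sup>T)"
  proof (rule mat_eqI_mult_vec)
    show "H \<in> carrier_mat m n" "c \<cdot>\<^sub>m (U * R * Q\<^sup>T) \<in> carrier_mat m n"
      by (rule carrier_matI; simp)+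
    fix y :: "'a vec" assume y: "y \<in> carrier_vec n"
    then have [simp]: "dim_vec y = n" by auto
    define w where "w = Q\<^sup>T *\<^sub>v y"
    have w: "w \<in> carrier_vec p" by (rule carrier_vecI) (simp add: w_def)
    then have [simp]: "dim_vec w = p" by auto
    \<comment> \<open>For \<open>u = 0\<close> the second equation reads \<open>b = - Z a\<close>,
      and the first becomes \<open>(I - Y Z) a = c w\<close>.\<close>
    let ?a = "c \<cdot>\<^sub>v (R *\<^sub>v w)"
    let ?b = "(- 1) \<cdot>\<^sub>v (Z *\<^sub>v ?a)"
    have eq: "P *\<^sub>v 0\<^sub>v m + U *\<^sub>v ?a = F *\<^sub>v 0\<^sub>v m + H *\<^sub>v y"
    proof (rule transfer_F[OF _ y])
      show "?a \<in> carrier_vec p" "?b \<in> carrier_vec q" "0\<^sub>v m \<in> carrier_vec m"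
        by (rule carrier_vecI; simp)+
      show "?a + Y *\<^sub>v ?b = c \<cdot>\<^sub>v (Q\<^sup>T *\<^sub>v y)"
        by (rule eq_vecI)
          (simp_all add: mv YZR[OF w] w_def[symmetric] right_diff_distrib del: index_mult_mat_vec)
      show "?b + Z *\<^sub>v ?a = c \<cdot>\<^sub>v (V\<^sup>T *\<^sub>v 0\<^sub>v m)"
        by (rule eq_vecI) (simp_all add: mv del: index_mult_mat_vec)
    qed
    show "H *\<^sub>v y = (c \<cdot>\<^sub>m (U * R * Q\<^sup>T)) *\<^sub>v y"
    proof (rule eq_vecI)
      fix i assume "i < dim_vec ((c \<cdot>\<^sub>m (U * R * Q\<^sup>T)) *\<^sub>v y)"
      then show "(H *\<^sub>v y) $ i = ((c \<cdot>\<^sub>m (U * R * Q\<^sup>T)) *\<^sub>v y) $ i"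
        using arg_cong[OF eq, of "\<lambda>v. v $ i"]
        by (simp add: mv w_def del: index_mult_mat_vec)
    qed simp
  qed
qed

text \<open>The corner block comes from the coupling: the stage of \<open>(a0, b0)\<close> receives
  \<open>P' y + W b1\<close> in place of \<open>y\<close>, and \<open>c Q\<^sup>T W b1\<close> is
  moved to the left. Stacking \<open>a\<close> and \<open>b\<close> in opposite orders puts
  \<open>Y\<close> on the antidiagonal; the dual instance splits the second equation of the
  system.\<close>

lemma block_eq_iff:
  assumes y: "y \<in> carrier_vec n"
    and a: "a1 \<in> carrier_vec p" "a0 \<in> carrier_vec p" and b: "b0 \<in> carrier_vec q" "b1 \<in> carrier_vec q"
  shows "(a1 @\<^sub>v a0) + four_block_mat (0\<^sub>m p q) Y Y ((- c) \<cdot>\<^sub>m (Q\<^sup>T * W)) *\<^sub>v (b0 @\<^sub>v b1)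
      = c \<cdot>\<^sub>v ((append_cols Q (P'\<^sup>T * Q))\<^sup>T *\<^sub>v y)
    \<longleftrightarrow> a1 + Y *\<^sub>v b1 = c \<cdot>\<^sub>v (Q\<^sup>T *\<^sub>v y)
      \<and> a0 + (Y *\<^sub>v b0 + (- c) \<cdot>\<^sub>v (Q\<^sup>T *\<^sub>v (W *\<^sub>v b1))) = c \<cdot>\<^sub>v (Q\<^sup>T *\<^sub>v (P' *\<^sub>v y))"
    (is "?l = ?r \<longleftrightarrow> ?e1 \<and> ?e2")
proof -
  have [simp]: "dim_vec y = n" "dim_vec a1 = p" "dim_vec a0 = p" "dim_vec b0 = q" "dim_vec b1 = q"
    using assms by auto
  have "four_block_mat (0\<^sub>m p q) Y Y ((- c) \<cdot>\<^sub>m (Q\<^sup>T * W)) *\<^sub>v (b0 @\<^sub>v b1)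
      = (0\<^sub>m p q *\<^sub>v b0 + Y *\<^sub>v b1) @\<^sub>v (Y *\<^sub>v b0 + ((- c) \<cdot>\<^sub>m (Q\<^sup>T * W)) *\<^sub>v b1)"
    by (rule four_block_mat_mult_vec[of _ p q _ q _ p]) (use b carrier(7) in \<open>simp_all add: carrier_matI\<close>)
  also have "0\<^sub>m p q *\<^sub>v b0 + Y *\<^sub>v b1 = Y *\<^sub>v b1"
    by (rule eq_vecI) (simp_all add: mv del: index_mult_mat_vec)
  also have "((- c) \<cdot>\<^sub>m (Q\<^sup>T * W)) *\<^sub>v b1 = (- c) \<cdot>\<^sub>v (Q\<^sup>T *\<^sub>v (W *\<^sub>v b1))"
    by (simp add: mv)
  finally have l: "?l = (a1 + Y *\<^sub>v b1)
      @\<^sub>v (a0 + (Y *\<^sub>v b0 + (- c) \<cdot>\<^sub>v (Q\<^sup>T *\<^sub>v (W *\<^sub>v b1))))"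
    by (intro eq_vecI) (simp_all del: index_mult_mat_vec)
  have "(append_cols Q (P'\<^sup>T * Q))\<^sup>T *\<^sub>v y = (Q\<^sup>T *\<^sub>v y) @\<^sub>v ((P'\<^sup>T * Q)\<^sup>T *\<^sub>v y)"
    by (rule append_cols_transpose_mult_vec[of _ n p _ p]) (simp_all add: carrier_matI y)
  also have "(P'\<^sup>T * Q)\<^sup>T *\<^sub>v y = Q\<^sup>T *\<^sub>v (P' *\<^sub>v y)"
    by (simp add: mv transpose_mult_dims)
  finally have r: "?r = (c \<cdot>\<^sub>v (Q\<^sup>T *\<^sub>v y)) @\<^sub>v (c \<cdot>\<^sub>v (Q\<^sup>T *\<^sub>v (P' *\<^sub>v y)))"
    by (intro eq_vecI) (simp_all del: index_mult_mat_vec)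
  show ?thesis unfolding l r
    by (rule append_vec_eq[of _ p]) (rule carrier_vecI; simp)+
qed

text \<open>\<open>u1\<close> and \<open>y1\<close> are the intermediate values of two consecutive stages;
  eliminating them inverts \<open>1\<^sub>m m - H * G\<close>.\<close>

lemma two_stages:
  fixes u y a1 a0 b0 b1
  defines "u1 \<equiv> P *\<^sub>v u + U *\<^sub>v a0" and "y1 \<equiv> P' *\<^sub>v y + W *\<^sub>v b1"
  assumes inv: "invertible_mat (1\<^sub>m m - H * G)"
    and u: "u \<in> carrier_vec m" and y: "y \<in> carrier_vec n"
    and a: "a1 \<in> carrier_vec p" "a0 \<in> carrier_vec p" and b: "b0 \<in> carrier_vec q" "b1 \<in> carrier_vec q"
    and e1: "a1 + Y *\<^sub>v b1 = c \<cdot>\<^sub>v (Q\<^sup>T *\<^sub>v y)"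
    and e2: "a0 + (Y *\<^sub>v b0 + (- c) \<cdot>\<^sub>v (Q\<^sup>T *\<^sub>v (W *\<^sub>v b1))) = c \<cdot>\<^sub>v (Q\<^sup>T *\<^sub>v (P' *\<^sub>v y))"
    and e3: "b0 + Z *\<^sub>v a0 = c \<cdot>\<^sub>v (V\<^sup>T *\<^sub>v u)"
    and e4: "b1 + (Z *\<^sub>v a1 + (- c) \<cdot>\<^sub>v (V\<^sup>T *\<^sub>v (U *\<^sub>v a0))) = c \<cdot>\<^sub>v (V\<^sup>T *\<^sub>v (P *\<^sub>v u))"
  shows "a0 + Y *\<^sub>v b0 = c \<cdot>\<^sub>v (Q\<^sup>T *\<^sub>v y1)"
    and "u1 = mat_inv (1\<^sub>m m - H * G) *\<^sub>v (F *\<^sub>v u + H *\<^sub>v (E *\<^sub>v y))"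
    and "P *\<^sub>v u1 + U *\<^sub>v a1 = F *\<^sub>v u1 + H *\<^sub>v y"
proof -
  have [simp]: "dim_vec u = m" "dim_vec y = n" "dim_vec a1 = p" "dim_vec a0 = p"
    "dim_vec b0 = q" "dim_vec b1 = q"
    using assms by auto
  have [simp]: "dim_vec u1 = m" "dim_vec y1 = n"
    unfolding u1_def y1_def by simp_all
  have u1: "u1 \<in> carrier_vec m" and y1: "y1 \<in> carrier_vec n" by (simp_all add: carrier_vecI)
  \<comment> \<open>Moving the corner term back to the right merges \<open>P' y\<close> and
    \<open>W b1\<close> into \<open>y1\<close>, so that \<open>(a0, b0)\<close> solves the system of
    a single stage.\<close>
  show s1: "a0 + Y *\<^sub>v b0 = c \<cdot>\<^sub>v (Q\<^sup>T *\<^sub>v y1)"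
  proof (rule eq_vecI)
    fix i assume "i < dim_vec (c \<cdot>\<^sub>v (Q\<^sup>T *\<^sub>v y1))"
    then show "(a0 + Y *\<^sub>v b0) $ i = (c \<cdot>\<^sub>v (Q\<^sup>T *\<^sub>v y1)) $ i"
      using arg_cong[OF e2, of "\<lambda>v. v $ i"]
      by (simp add: mv y1_def ring_distribs add_diff_eq diff_eq_eq del: index_mult_mat_vec)
  qed simp
  have s2: "b1 + Z *\<^sub>v a1 = c \<cdot>\<^sub>v (V\<^sup>T *\<^sub>v u1)"
  proof (rule eq_vecI)
    fix i assume "i < dim_vec (c \<cdot>\<^sub>v (V\<^sup>T *\<^sub>v u1))"
    then show "(b1 + Z *\<^sub>v a1) $ i = (c \<cdot>\<^sub>v (V\<^sup>T *\<^sub>v u1)) $ i"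
      using arg_cong[OF e4, of "\<lambda>v. v $ i"]
      by (simp add: mv u1_def ring_distribs add_diff_eq diff_eq_eq del: index_mult_mat_vec)
  qed simp
  \<comment> \<open>\<open>(a0, b0)\<close> is a solution for the inputs \<open>u\<close> and
    \<open>y1\<close>, and \<open>(a1, b1)\<close> one for \<open>u1\<close> and \<open>y\<close>:
    each intermediate value is an output of one stage and an input of the other.\<close>
  have u1_eq: "u1 = F *\<^sub>v u + H *\<^sub>v y1"
    unfolding u1_def by (rule transfer_F[OF u y1 a(2) b(1) s1 e3])
  have y1_eq: "y1 = E *\<^sub>v y + G *\<^sub>v u1"
    unfolding y1_def by (rule transfer_E[OF u1 y a(1) b(2) e1 s2])
  show "P *\<^sub>v u1 + U *\<^sub>v a1 = F *\<^sub>v u1 + H *\<^sub>v y"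
    by (rule transfer_F[OF u1 y a(1) b(2) e1 s2])
  have N: "1\<^sub>m m - H * G \<in> carrier_mat m m" by (rule carrier_matI) simp_all
  \<comment> \<open>Eliminating \<open>y1\<close> leaves a linear equation for \<open>u1\<close>
    with matrix \<open>I - H G\<close>; this is the source of the inverse in the SDA update.\<close>
  have "u1 - H *\<^sub>v (G *\<^sub>v u1) = F *\<^sub>v u + H *\<^sub>v (E *\<^sub>v y)"
  proof (rule eq_vecI)
    have eq: "u1 = F *\<^sub>v u + H *\<^sub>v (E *\<^sub>v y + G *\<^sub>v u1)"
      using u1_eq unfolding y1_eq[symmetric] .
    fix i assume "i < dim_vec (F *\<^sub>v u + H *\<^sub>v (E *\<^sub>v y))"
    then show "(u1 - H *\<^sub>v (G *\<^sub>v u1)) $ i = (F *\<^sub>v u + H *\<^sub>v (E *\<^sub>v y)) $ i"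
      using arg_cong[OF eq, of "\<lambda>v. v $ i"]
      by (simp add: mv diff_eq_eq add.assoc del: index_mult_mat_vec)
  qed simp
  then have "(1\<^sub>m m - H * G) *\<^sub>v u1 = F *\<^sub>v u + H *\<^sub>v (E *\<^sub>v y)"
    by (simp add: mv)
  then show "u1 = mat_inv (1\<^sub>m m - H * G) *\<^sub>v (F *\<^sub>v u + H *\<^sub>v (E *\<^sub>v y))"
    using mat_inv_mult_vec_cancel[OF N inv u1] by simp
qed

text \<open>\<open>block_eq_iff\<close> and its dual split a solution of the doubled system into two
  coupled stages, and \<open>two_stages\<close> expresses the intermediate values by the inputs. The
  output \<open>F u1 + H y\<close> of the second stage then becomes the SDA update.\<close>

lemma step:
  assumes HG: "invertible_mat (1\<^sub>m m - H * G)" and GH: "invertible_mat (1\<^sub>m n - G * H)"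
  shows "sda_stage m n (p + p) (q + q) c (P * P) (P' * P')
    (append_cols U (P * U)) (append_cols V (P\<^sup>T * V)) (append_cols W (P' * W)) (append_cols Q (P'\<^sup>T * Q))
    (four_block_mat (0\<^sub>m p q) Y Y ((- c) \<cdot>\<^sub>m (Q\<^sup>T * W)))
    (four_block_mat (0\<^sub>m q p) Z Z ((- c) \<cdot>\<^sub>m (V\<^sup>T * U)))
    (F * mat_inv (1\<^sub>m m - H * G) * F) (E * mat_inv (1\<^sub>m n - G * H) * E)
    (H + F * mat_inv (1\<^sub>m m - H * G) * H * E) (G + E * mat_inv (1\<^sub>m n - G * H) * G * F)"
proof -
  interpret D: sda_stage n m q p c P' P W Q U V Z Y E F G H by (rule dual)
  let ?Y = "four_block_mat (0\<^sub>m p q) Y Y ((- c) \<cdot>\<^sub>m (Q\<^sup>T * W))"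
  let ?Z = "four_block_mat (0\<^sub>m q p) Z Z ((- c) \<cdot>\<^sub>m (V\<^sup>T * U))"
  define M where "M = mat_inv (1\<^sub>m m - H * G)"
  define M' where "M' = mat_inv (1\<^sub>m n - G * H)"
  have M: "M \<in> carrier_mat m m" unfolding M_def
    by (rule mat_inv_carrier[OF _ HG], rule carrier_matI) simp_all
  have M': "M' \<in> carrier_mat n n" unfolding M'_def
    by (rule mat_inv_carrier[OF _ GH], rule carrier_matI) simp_all
  note [simp] = carrier_matD[OF M] carrier_matD[OF M']
  have split: "\<exists>x1 x0. x1 \<in> carrier_vec d \<and> x0 \<in> carrier_vec d \<and> x = x1 @\<^sub>v x0"
    if "x \<in> carrier_vec (d + d)" for x :: "'a vec" and d
    using that by (metis vec_first_last_append vec_first_carrier vec_last_carrier)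
  show ?thesis unfolding M_def[symmetric] M'_def[symmetric]
  proof
    show "P * P \<in> carrier_mat m m" "P' * P' \<in> carrier_mat n n"
      "append_cols U (P * U) \<in> carrier_mat m (p + p)" "append_cols V (P\<^sup>T * V) \<in> carrier_mat m (q + q)"
      "append_cols W (P' * W) \<in> carrier_mat n (q + q)" "append_cols Q (P'\<^sup>T * Q) \<in> carrier_mat n (p + p)"
      "?Y \<in> carrier_mat (p + p) (q + q)" "?Z \<in> carrier_mat (q + q) (p + p)"
      "F * M * F \<in> carrier_mat m m" "E * M' * E \<in> carrier_mat n n"
      "H + F * M * H * E \<in> carrier_mat m n" "G + E * M' * G * F \<in> carrier_mat n m"
      by (rule carrier_matI; simp add: append_cols_def)+
  next
    fix a assume a: "a \<in> carrier_vec (p + p)" and fixed: "?Y *\<^sub>v (?Z *\<^sub>v a) = a"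
    obtain a1 a0 where a': "a1 \<in> carrier_vec p" "a0 \<in> carrier_vec p" "a = a1 @\<^sub>v a0"
      using split[OF a] by blast
    \<comment> \<open>The partner \<open>b = - ?Z a\<close> makes the second doubled equation
      trivial for zero input, and the assumption that \<open>a\<close> is fixed turns into the first
      one.\<close>
    have "(- 1) \<cdot>\<^sub>v (?Z *\<^sub>v a) \<in> carrier_vec (q + q)" by (rule carrier_vecI) simp
    then obtain b0 b1 where b: "b0 \<in> carrier_vec q" "b1 \<in> carrier_vec q"
      and ba: "(- 1) \<cdot>\<^sub>v (?Z *\<^sub>v a) = b0 @\<^sub>v b1"
      using split by blast
    have da: "dim_vec a = p + p" using a by simp
    have z: "0\<^sub>v n \<in> carrier_vec n" "0\<^sub>v m \<in> carrier_vec m" by simp_all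
    have "a + ?Y *\<^sub>v ((- 1) \<cdot>\<^sub>v (?Z *\<^sub>v a)) = c \<cdot>\<^sub>v ((append_cols Q (P'\<^sup>T * Q))\<^sup>T *\<^sub>v 0\<^sub>v n)"
      by (rule eq_vecI)
        (simp_all add: mv fixed da append_cols_def del: index_mult_mat_vec)
    then have e12: "a1 + Y *\<^sub>v b1 = c \<cdot>\<^sub>v (Q\<^sup>T *\<^sub>v 0\<^sub>v n)"
        "a0 + (Y *\<^sub>v b0 + (- c) \<cdot>\<^sub>v (Q\<^sup>T *\<^sub>v (W *\<^sub>v b1))) = c \<cdot>\<^sub>v (Q\<^sup>T *\<^sub>v (P' *\<^sub>v 0\<^sub>v n))"
      unfolding ba unfolding a'(3) using block_eq_iff[OF z(1) a'(1,2) b] by blast+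
    have "(- 1) \<cdot>\<^sub>v (?Z *\<^sub>v a) + ?Z *\<^sub>v a = c \<cdot>\<^sub>v ((append_cols V (P\<^sup>T * V))\<^sup>T *\<^sub>v 0\<^sub>v m)"
      by (rule eq_vecI)
        (simp_all add: mv append_cols_def del: index_mult_mat_vec)
    then have e34: "b0 + Z *\<^sub>v a0 = c \<cdot>\<^sub>v (V\<^sup>T *\<^sub>v 0\<^sub>v m)"
        "b1 + (Z *\<^sub>v a1 + (- c) \<cdot>\<^sub>v (V\<^sup>T *\<^sub>v (U *\<^sub>v a0))) = c \<cdot>\<^sub>v (V\<^sup>T *\<^sub>v (P *\<^sub>v 0\<^sub>v m))"
      unfolding ba unfolding a'(3) using D.block_eq_iff[OF z(2) b a'(1,2)] by blast+
    note s = two_stages[OF HG z(2,1) a'(1,2) b e12 e34]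
    \<comment> \<open>The opposite stacking orders make the four equations self-dual, so the dual
      lemma applies to them with \<open>a\<close> and \<open>b\<close> exchanged.\<close>
    note s' = D.two_stages[OF GH z b a'(1,2) e34 e12]
    \<comment> \<open>For zero inputs both intermediate values are an inverse applied to zero, so
      the coupling of the two stages disappears.\<close>
    have u1: "P *\<^sub>v 0\<^sub>v m + U *\<^sub>v a0 = 0\<^sub>v m"
      using s(2) by (simp add: mv M_def[symmetric])
    have y1: "P' *\<^sub>v 0\<^sub>v n + W *\<^sub>v b1 = 0\<^sub>v n"
      using s'(2) by (simp add: mv M'_def[symmetric])
    \<comment> \<open>Without coupling, each pair solves the homogeneous system of one stage;
      inserting \<open>Z x = - w\<close> exhibits \<open>x\<close> as a fixed vector of
      \<open>Y Z\<close>.\<close>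
    have null: "x = 0\<^sub>v p" if x: "x \<in> carrier_vec p" and w: "w \<in> carrier_vec q"
      and xw: "x + Y *\<^sub>v w = 0\<^sub>v p" and wx: "w + Z *\<^sub>v x = 0\<^sub>v q" for x w
    proof (rule YZ_fixed[OF x])
      have [simp]: "dim_vec x = p" "dim_vec w = q" using x w by auto
      have Zx: "Z *\<^sub>v x = (- 1) \<cdot>\<^sub>v w"
      proof (rule eq_vecI)
        fix i assume "i < dim_vec ((- 1) \<cdot>\<^sub>v w)"
        then show "(Z *\<^sub>v x) $ i = ((- 1) \<cdot>\<^sub>v w) $ i"
          using arg_cong[OF wx, of "\<lambda>v. v $ i"]
          by (simp add: add_eq_0_iff del: index_mult_mat_vec)
      qed simp
      show "Y *\<^sub>v (Z *\<^sub>v x) = x"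
      proof (rule eq_vecI)
        fix i assume "i < dim_vec x"
        then show "(Y *\<^sub>v (Z *\<^sub>v x)) $ i = x $ i"
          using arg_cong[OF xw, of "\<lambda>v. v $ i"]
          by (simp add: Zx mv add_eq_0_iff del: index_mult_mat_vec)
      qed simp
    qed
    have "a1 = 0\<^sub>v p"
      by (rule null[OF a'(1) b(2)]) (use e12(1) s'(1)[unfolded u1] in \<open>simp_all add: mv\<close>)
    moreover have "a0 = 0\<^sub>v p"
      by (rule null[OF a'(2) b(1)]) (use e34(1) s(1)[unfolded y1] in \<open>simp_all add: mv\<close>)
    ultimately show "a = 0\<^sub>v (p + p)"
      unfolding a'(3) by (intro eq_vecI) auto
  next
    fix u y a b
    assume u: "u \<in> carrier_vec m" and y: "y \<in> carrier_vec n"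
      and a: "a \<in> carrier_vec (p + p)" and b: "b \<in> carrier_vec (q + q)"
      and aeq: "a + ?Y *\<^sub>v b = c \<cdot>\<^sub>v ((append_cols Q (P'\<^sup>T * Q))\<^sup>T *\<^sub>v y)"
      and beq: "b + ?Z *\<^sub>v a = c \<cdot>\<^sub>v ((append_cols V (P\<^sup>T * V))\<^sup>T *\<^sub>v u)"
    obtain a1 a0 where a': "a1 \<in> carrier_vec p" "a0 \<in> carrier_vec p" "a = a1 @\<^sub>v a0"
      using split[OF a] by blast
    obtain b0 b1 where b': "b0 \<in> carrier_vec q" "b1 \<in> carrier_vec q" "b = b0 @\<^sub>v b1"
      using split[OF b] by blast
    have [simp]: "dim_vec u = m" "dim_vec y = n" "dim_vec a1 = p" "dim_vec a0 = p"
      "dim_vec b0 = q" "dim_vec b1 = q" using u y a' b' by auto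
    have e12: "a1 + Y *\<^sub>v b1 = c \<cdot>\<^sub>v (Q\<^sup>T *\<^sub>v y)"
        "a0 + (Y *\<^sub>v b0 + (- c) \<cdot>\<^sub>v (Q\<^sup>T *\<^sub>v (W *\<^sub>v b1))) = c \<cdot>\<^sub>v (Q\<^sup>T *\<^sub>v (P' *\<^sub>v y))"
      using aeq block_eq_iff[OF y a'(1,2) b'(1,2)] unfolding a'(3) b'(3) by blast+
    have e34: "b0 + Z *\<^sub>v a0 = c \<cdot>\<^sub>v (V\<^sup>T *\<^sub>v u)"
        "b1 + (Z *\<^sub>v a1 + (- c) \<cdot>\<^sub>v (V\<^sup>T *\<^sub>v (U *\<^sub>v a0))) = c \<cdot>\<^sub>v (V\<^sup>T *\<^sub>v (P *\<^sub>v u))"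
      using beq D.block_eq_iff[OF u b'(1,2) a'(1,2)] unfolding a'(3) b'(3) by blast+
    note s = two_stages[OF HG u y a'(1,2) b'(1,2) e12 e34, folded M_def]
    note s' = D.two_stages[OF GH y u b'(1,2) a'(1,2) e34 e12, folded M'_def]
    have "append_cols U (P * U) *\<^sub>v a = U *\<^sub>v a1 + (P * U) *\<^sub>v a0"
      unfolding a'(3) by (rule append_cols_mult_vec[of _ m p _ p]) (simp_all add: carrier_matI a')
    \<comment> \<open>The terms regroup so that the output \<open>P u + U a0\<close> of the first
      stage is passed on to the second.\<close>
    then have "(P * P) *\<^sub>v u + append_cols U (P * U) *\<^sub>v a = P *\<^sub>v (P *\<^sub>v u + U *\<^sub>v a0) + U *\<^sub>v a1"
      by (intro eq_vecI) (simp_all add: mv del: index_mult_mat_vec)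
    then show "(P * P) *\<^sub>v u + append_cols U (P * U) *\<^sub>v a
        = (F * M * F) *\<^sub>v u + (H + F * M * H * E) *\<^sub>v y"
      unfolding s(3) unfolding s(2)
      by (auto intro!: eq_vecI simp add: mv simp del: index_mult_mat_vec)
    have "append_cols W (P' * W) *\<^sub>v b = W *\<^sub>v b0 + (P' * W) *\<^sub>v b1"
      unfolding b'(3) by (rule append_cols_mult_vec[of _ n q _ q]) (simp_all add: carrier_matI b')
    then have "(P' * P') *\<^sub>v y + append_cols W (P' * W) *\<^sub>v b = P' *\<^sub>v (P' *\<^sub>v y + W *\<^sub>v b1) + W *\<^sub>v b0"
      by (intro eq_vecI) (simp_all add: mv del: index_mult_mat_vec)
    then show "(P' * P') *\<^sub>v y + append_cols W (P' * W) *\<^sub>v b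
        = (E * M' * E) *\<^sub>v y + (G + E * M' * G * F) *\<^sub>v u"
      unfolding s'(3) unfolding s'(2)
      by (auto intro!: eq_vecI simp add: mv simp del: index_mult_mat_vec)
  qed
qed

end

section \<open>The starting values\<close>

text \<open>The differences \<open>du\<close> and \<open>dy\<close> between inputs and outputs
  satisfy \<open>A du + B dy = c u\<close> and \<open>C du + D dy = c y\<close>. \<open>Wg\<close>
  and \<open>Vg\<close> are the Schur complements of \<open>D\<close> and \<open>A\<close> in this
  block system, so block elimination yields the starting iterates. The shift by \<gamma> is already
  contained in \<open>A\<close> and \<open>D\<close> here.\<close>

lemma sda_stage_init:
  fixes A B C D Bl Br Cl Cr Wg Vg :: "'a :: field mat" and c :: 'a
  assumes A: "A \<in> carrier_mat m m" "invertible_mat A" and D: "D \<in> carrier_mat n n" "invertible_mat D"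
    and carriers: "Bl \<in> carrier_mat m p" "Br \<in> carrier_mat n p" "Cl \<in> carrier_mat n q" "Cr \<in> carrier_mat m q"
    and B: "B = Bl * Br\<^sup>T" and C: "C = Cl * Cr\<^sup>T"
    and Wg: "Wg = A - B * mat_inv D * C" "invertible_mat Wg"
    and Vg: "Vg = D - C * mat_inv A * B" "invertible_mat Vg"
  shows "sda_stage m n p q c (1\<^sub>m m - c \<cdot>\<^sub>m mat_inv A) (1\<^sub>m n - c \<cdot>\<^sub>m mat_inv D)
    (mat_inv A * Bl) ((mat_inv A)\<^sup>T * Cr) (mat_inv D * Cl) ((mat_inv D)\<^sup>T * Br)
    (Br\<^sup>T * mat_inv D * Cl) (Cr\<^sup>T * mat_inv A * Bl)
    (1\<^sub>m m - c \<cdot>\<^sub>m mat_inv Wg) (1\<^sub>m n - c \<cdot>\<^sub>m mat_inv Vg)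
    (c \<cdot>\<^sub>m (mat_inv Wg * B * mat_inv D)) (c \<cdot>\<^sub>m (mat_inv D * C * mat_inv Wg))"
proof -
  note mv = mult_mat_vec_distribs transpose_mult_dims
  define Ai where "Ai = mat_inv A"
  define Di where "Di = mat_inv D"
  define Wi where "Wi = mat_inv Wg"
  define Vi where "Vi = mat_inv Vg"
  have cAD: "Ai \<in> carrier_mat m m" "Di \<in> carrier_mat n n"
    unfolding Ai_def Di_def by (rule mat_inv_carrier[OF A] mat_inv_carrier[OF D])+
  note [simp] = carrier_matD[OF A(1)] carrier_matD[OF D(1)]
    carriers[THEN carrier_matD(1)] carriers[THEN carrier_matD(2)]
    cAD[THEN carrier_matD(1)] cAD[THEN carrier_matD(2)]
  have BC: "dim_row B = m" "dim_col B = n" "dim_row C = n" "dim_col C = m"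
    unfolding B C by simp_all
  have Wg': "Wg = A - B * Di * C" and Vg': "Vg = D - C * Ai * B"
    using Wg Vg by (simp_all add: Ai_def Di_def)
  have cWg: "Wg \<in> carrier_mat m m" and cVg: "Vg \<in> carrier_mat n n"
    unfolding Wg' Vg' by (rule carrier_matI; simp add: BC)+
  have cWV: "Wi \<in> carrier_mat m m" "Vi \<in> carrier_mat n n"
    unfolding Wi_def Vi_def by (rule mat_inv_carrier[OF cWg Wg(2)] mat_inv_carrier[OF cVg Vg(2)])+
  note [simp] = BC cWV[THEN carrier_matD(1)] cWV[THEN carrier_matD(2)]
  have inv: "\<And>x. dim_vec x = m \<Longrightarrow> A *\<^sub>v (Ai *\<^sub>v x) = x" "\<And>x. dim_vec x = m \<Longrightarrow> Ai *\<^sub>v (A *\<^sub>v x) = x"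
    "\<And>x. dim_vec x = n \<Longrightarrow> D *\<^sub>v (Di *\<^sub>v x) = x" "\<And>x. dim_vec x = n \<Longrightarrow> Di *\<^sub>v (D *\<^sub>v x) = x"
    "\<And>x. dim_vec x = m \<Longrightarrow> Wi *\<^sub>v (Wg *\<^sub>v x) = x" "\<And>x. dim_vec x = n \<Longrightarrow> Vi *\<^sub>v (Vg *\<^sub>v x) = x"
    "\<And>x. dim_vec x = m \<Longrightarrow> Wg *\<^sub>v (Wi *\<^sub>v x) = x"
    unfolding Ai_def Di_def Wi_def Vi_def
    using mat_inv_mult_vec[OF A] mat_inv_mult_vec[OF D] mat_inv_mult_vec[OF cWg Wg(2)]
      mat_inv_mult_vec[OF cVg Vg(2)] by (metis carrier_vecI)+
  have Bv: "B *\<^sub>v x = Bl *\<^sub>v (Br\<^sup>T *\<^sub>v x)" if "dim_vec x = n" for x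
    using that by (simp add: B mv)
  have Cv: "C *\<^sub>v x = Cl *\<^sub>v (Cr\<^sup>T *\<^sub>v x)" if "dim_vec x = m" for x
    using that by (simp add: C mv)
  have Wgv: "Wg *\<^sub>v x = A *\<^sub>v x - B *\<^sub>v (Di *\<^sub>v (C *\<^sub>v x))" if "dim_vec x = m" for x
    using that by (simp add: Wg' mv)
  have Vgv: "Vg *\<^sub>v x = D *\<^sub>v x - C *\<^sub>v (Ai *\<^sub>v (B *\<^sub>v x))" if "dim_vec x = n" for x
    using that by (simp add: Vg' mv)
  \<comment> \<open>Push-through identity: both sides of \<open>C Ai Wg = Vg Di C\<close> equal
    \<open>C - C Ai B Di C\<close>. Elimination of \<open>du\<close> produces the form with
    \<open>Vi\<close>, while the starting value of \<open>G\<close> is written with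
    \<open>Wi\<close>.\<close>
  have push: "Vi *\<^sub>v (C *\<^sub>v (Ai *\<^sub>v x)) = Di *\<^sub>v (C *\<^sub>v (Wi *\<^sub>v x))" if x: "dim_vec x = m" for x
  proof -
    define w where "w = Wi *\<^sub>v x"
    have [simp]: "dim_vec w = m" by (simp add: w_def)
    have "x = Wg *\<^sub>v w" by (simp add: w_def inv x)
    then have "Ai *\<^sub>v x = w - Ai *\<^sub>v (B *\<^sub>v (Di *\<^sub>v (C *\<^sub>v w)))"
      by (simp add: Wgv mv inv)
    then have "C *\<^sub>v (Ai *\<^sub>v x) = Vg *\<^sub>v (Di *\<^sub>v (C *\<^sub>v w))"
      by (simp add: Vgv mv inv)
    then show ?thesis by (simp add: inv w_def)
  qed
  show ?thesis unfolding Ai_def[symmetric] Di_def[symmetric] Wi_def[symmetric] Vi_def[symmetric]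
  proof
    show "1\<^sub>m m - c \<cdot>\<^sub>m Ai \<in> carrier_mat m m" "1\<^sub>m n - c \<cdot>\<^sub>m Di \<in> carrier_mat n n"
      "Ai * Bl \<in> carrier_mat m p" "Ai\<^sup>T * Cr \<in> carrier_mat m q"
      "Di * Cl \<in> carrier_mat n q" "Di\<^sup>T * Br \<in> carrier_mat n p"
      "Br\<^sup>T * Di * Cl \<in> carrier_mat p q" "Cr\<^sup>T * Ai * Bl \<in> carrier_mat q p"
      "1\<^sub>m m - c \<cdot>\<^sub>m Wi \<in> carrier_mat m m" "1\<^sub>m n - c \<cdot>\<^sub>m Vi \<in> carrier_mat n n"
      "c \<cdot>\<^sub>m (Wi * B * Di) \<in> carrier_mat m n" "c \<cdot>\<^sub>m (Di * C * Wi) \<in> carrier_mat n m"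
      by (rule carrier_matI; simp)+
  next
    fix a assume "a \<in> carrier_vec p" and fixed: "Br\<^sup>T * Di * Cl *\<^sub>v (Cr\<^sup>T * Ai * Bl *\<^sub>v a) = a"
    then have [simp]: "dim_vec a = p" by auto
    \<comment> \<open>\<open>a\<close> is recovered from \<open>x\<close>, so it is enough that
      \<open>x\<close> vanishes; the fixed vector equation becomes \<open>A x = B Di C x\<close>,
      that is, \<open>Wg x = 0\<close>.\<close>
    define x where "x = Ai *\<^sub>v (Bl *\<^sub>v a)"
    have [simp]: "dim_vec x = m" by (simp add: x_def)
    have a: "a = Br\<^sup>T *\<^sub>v (Di *\<^sub>v (C *\<^sub>v x))"
      using fixed by (simp add: Cv mv x_def)
    have "B *\<^sub>v (Di *\<^sub>v (C *\<^sub>v x)) = Bl *\<^sub>v a"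
      by (simp add: Bv a[symmetric])
    then have "A *\<^sub>v x = B *\<^sub>v (Di *\<^sub>v (C *\<^sub>v x))"
      by (simp add: x_def inv)
    then have "Wg *\<^sub>v x = 0\<^sub>v m"
      by (intro eq_vecI) (simp_all add: Wgv del: index_mult_mat_vec)
    then have "x = 0\<^sub>v m" using inv(5)[of x] by (simp add: mv)
    then show "a = 0\<^sub>v p" by (subst a) (simp add: mv)
  next
    fix u y a b
    assume "u \<in> carrier_vec m" "y \<in> carrier_vec n" "a \<in> carrier_vec p" "b \<in> carrier_vec q"
      and eq_a: "a + Br\<^sup>T * Di * Cl *\<^sub>v b = c \<cdot>\<^sub>v ((Di\<^sup>T * Br)\<^sup>T *\<^sub>v y)"
      and eq_b: "b + Cr\<^sup>T * Ai * Bl *\<^sub>v a = c \<cdot>\<^sub>v ((Ai\<^sup>T * Cr)\<^sup>T *\<^sub>v u)"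
    then have [simp]: "dim_vec u = m" "dim_vec y = n" "dim_vec a = p" "dim_vec b = q" by auto
    \<comment> \<open>\<open>u - du\<close> and \<open>y - dy\<close> are the two outputs. The
      implicit equations become \<open>a = Br\<^sup>T dy\<close> and
      \<open>b = Cr\<^sup>T du\<close>, which reassembles \<open>B\<close> and \<open>C\<close> from
      their factors.\<close>
    define du where "du = c \<cdot>\<^sub>v (Ai *\<^sub>v u) - Ai *\<^sub>v (Bl *\<^sub>v a)"
    define dy where "dy = c \<cdot>\<^sub>v (Di *\<^sub>v y) - Di *\<^sub>v (Cl *\<^sub>v b)"
    have [simp]: "dim_vec du = m" "dim_vec dy = n" by (simp_all add: du_def dy_def)
    have "a = Br\<^sup>T *\<^sub>v dy"
    proof (rule eq_vecI)
      fix i assume "i < dim_vec (Br\<^sup>T *\<^sub>v dy)"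
      then show "a $ i = (Br\<^sup>T *\<^sub>v dy) $ i"
        using arg_cong[OF eq_a, of "\<lambda>v. v $ i"]
        by (simp add: mv dy_def eq_diff_eq del: index_mult_mat_vec)
    qed simp
    then have Bla: "Bl *\<^sub>v a = B *\<^sub>v dy" by (simp add: Bv)
    have "b = Cr\<^sup>T *\<^sub>v du"
    proof (rule eq_vecI)
      fix i assume "i < dim_vec (Cr\<^sup>T *\<^sub>v du)"
      then show "b $ i = (Cr\<^sup>T *\<^sub>v du) $ i"
        using arg_cong[OF eq_b, of "\<lambda>v. v $ i"]
        by (simp add: mv du_def eq_diff_eq del: index_mult_mat_vec)
    qed simp
    then have Clb: "Cl *\<^sub>v b = C *\<^sub>v du" by (simp add: Cv)
    have "Wg *\<^sub>v du = c \<cdot>\<^sub>v u - c \<cdot>\<^sub>v (B *\<^sub>v (Di *\<^sub>v y))"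
    proof -
      have "A *\<^sub>v du = c \<cdot>\<^sub>v u - (c \<cdot>\<^sub>v (B *\<^sub>v (Di *\<^sub>v y)) - B *\<^sub>v (Di *\<^sub>v (C *\<^sub>v du)))"
        by (subst du_def) (simp add: mv inv Bla dy_def Clb)
      then show ?thesis by (subst Wgv) (auto intro!: eq_vecI simp del: index_mult_mat_vec)
    qed
    then have du: "du = c \<cdot>\<^sub>v (Wi *\<^sub>v u) - c \<cdot>\<^sub>v (Wi *\<^sub>v (B *\<^sub>v (Di *\<^sub>v y)))"
      using inv(5)[of du] by (simp add: mv)
    have "Vg *\<^sub>v dy = c \<cdot>\<^sub>v y - c \<cdot>\<^sub>v (C *\<^sub>v (Ai *\<^sub>v u))"
    proof -
      have "D *\<^sub>v dy = c \<cdot>\<^sub>v y - (c \<cdot>\<^sub>v (C *\<^sub>v (Ai *\<^sub>v u)) - C *\<^sub>v (Ai *\<^sub>v (B *\<^sub>v dy)))"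
        by (subst dy_def) (simp add: mv inv Clb du_def Bla)
      then show ?thesis by (subst Vgv) (auto intro!: eq_vecI simp del: index_mult_mat_vec)
    qed
    then have dy: "dy = c \<cdot>\<^sub>v (Vi *\<^sub>v y) - c \<cdot>\<^sub>v (Di *\<^sub>v (C *\<^sub>v (Wi *\<^sub>v u)))"
      using inv(6)[of dy] by (simp add: mv push)
    have "(1\<^sub>m m - c \<cdot>\<^sub>m Ai) *\<^sub>v u + Ai * Bl *\<^sub>v a = u - du"
      unfolding du_def by (intro eq_vecI) (simp_all add: mv del: index_mult_mat_vec)
    then show "(1\<^sub>m m - c \<cdot>\<^sub>m Ai) *\<^sub>v u + Ai * Bl *\<^sub>v a
        = (1\<^sub>m m - c \<cdot>\<^sub>m Wi) *\<^sub>v u + c \<cdot>\<^sub>m (Wi * B * Di) *\<^sub>v y"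
      unfolding du by (auto intro!: eq_vecI simp add: mv simp del: index_mult_mat_vec)
    have "(1\<^sub>m n - c \<cdot>\<^sub>m Di) *\<^sub>v y + Di * Cl *\<^sub>v b = y - dy"
      unfolding dy_def by (intro eq_vecI) (simp_all add: mv del: index_mult_mat_vec)
    then show "(1\<^sub>m n - c \<cdot>\<^sub>m Di) *\<^sub>v y + Di * Cl *\<^sub>v b
        = (1\<^sub>m n - c \<cdot>\<^sub>m Vi) *\<^sub>v y + c \<cdot>\<^sub>m (Di * C * Wi) *\<^sub>v u"
      unfolding dy by (auto intro!: eq_vecI simp add: mv simp del: index_mult_mat_vec)
  qed
qed

section \<open>Induction along the doubling iteration\<close>

lemma block_row_one:
  fixes X :: "nat \<Rightarrow> 'a :: field mat"
  shows "block_row X 1 = X 0"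
  by (rule eq_matI) (simp_all add: append_cols_def)

lemma block_row_pow_double:
  fixes P :: "'a :: field mat"
  assumes P: "P \<in> carrier_mat r r" and X0: "X 0 \<in> carrier_mat r w"
    and rec: "\<And>i. X (Suc i) = P * X i"
  shows "block_row X (2 * k) = append_cols (block_row X k) (P ^\<^sub>m k * block_row X k)"
proof -
  have X: "X i \<in> carrier_mat r w" for i
    by (induction i) (use P X0 rec in auto)
  show "block_row X (2 * k) = append_cols (block_row X k) (P ^\<^sub>m k * block_row X k)"
    by (rule block_row_double[of X r w, OF X pow_mat_carrier[OF P]
        pow_mat_shift[of P r X w, OF P X rec]])
qed

text \<open>\<open>mat_inv\<close> is unspecified on singular matrices, so the formulas have their
  meaning only together with the invertibility of \<open>I - Y Z\<close> and \<open>I - Z Y\<close>,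
  which is therefore concluded as well.\<close>

theorem theorem3p4:
  fixes m n m1 n1 :: nat
    and A B C D Bl Br Cl Cr :: "real mat"
    and \<gamma> :: real
    and A\<gamma> D\<gamma> W\<gamma> V\<gamma> At Dt :: "real mat"
    and F E H G :: "nat \<Rightarrow> real mat"
    and U V W Q Uhat Vhat What Qhat T S Y Z :: "nat \<Rightarrow> real mat"
  assumes "A \<in> carrier_mat m m" and "D \<in> carrier_mat n n"
    and "B \<in> carrier_mat m n" and "C \<in> carrier_mat n m"
    and "Bl \<in> carrier_mat m m1" and "Br \<in> carrier_mat n m1"
    and "Cl \<in> carrier_mat n n1" and "Cr \<in> carrier_mat m n1"
    and "full_rank_factorization B Bl Br" and "full_rank_factorization C Cl Cr"
    and "\<gamma> \<ge> Max (set (diag_mat A) \<union> set (diag_mat D))"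
    and "A\<gamma> = A + \<gamma> \<cdot>\<^sub>m 1\<^sub>m m" and "D\<gamma> = D + \<gamma> \<cdot>\<^sub>m 1\<^sub>m n"
    and "W\<gamma> = A\<gamma> - B * mat_inv D\<gamma> * C" and "V\<gamma> = D\<gamma> - C * mat_inv A\<gamma> * B"
    and "invertible_mat A\<gamma>" and "invertible_mat D\<gamma>"
    and "invertible_mat W\<gamma>" and "invertible_mat V\<gamma>"
    and "F 0 = 1\<^sub>m m - (2 * \<gamma>) \<cdot>\<^sub>m mat_inv W\<gamma>"
    and "E 0 = 1\<^sub>m n - (2 * \<gamma>) \<cdot>\<^sub>m mat_inv V\<gamma>"
    and "H 0 = (2 * \<gamma>) \<cdot>\<^sub>m (mat_inv W\<gamma> * B * mat_inv D\<gamma>)"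
    and "G 0 = (2 * \<gamma>) \<cdot>\<^sub>m (mat_inv D\<gamma> * C * mat_inv W\<gamma>)"
    and "\<And>k. invertible_mat (1\<^sub>m m - H k * G k)"
    and "\<And>k. invertible_mat (1\<^sub>m n - G k * H k)"
    and "\<And>k. F (Suc k) = F k * mat_inv (1\<^sub>m m - H k * G k) * F k"
    and "\<And>k. E (Suc k) = E k * mat_inv (1\<^sub>m n - G k * H k) * E k"
    and "\<And>k. H (Suc k) = H k + F k * mat_inv (1\<^sub>m m - H k * G k) * H k * E k"
    and "\<And>k. G (Suc k) = G k + E k * mat_inv (1\<^sub>m n - G k * H k) * G k * F k"
    and "At = 1\<^sub>m m - (2 * \<gamma>) \<cdot>\<^sub>m mat_inv A\<gamma>" and "Dt = 1\<^sub>m n - (2 * \<gamma>) \<cdot>\<^sub>m mat_inv D\<gamma>"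
    and "U 0 = mat_inv A\<gamma> * Bl" and "V 0 = (mat_inv A\<gamma>)\<^sup>T * Cr"
    and "W 0 = mat_inv D\<gamma> * Cl" and "Q 0 = (mat_inv D\<gamma>)\<^sup>T * Br"
    and "Y 0 = Br\<^sup>T * mat_inv D\<gamma> * Cl" and "Z 0 = Cr\<^sup>T * mat_inv A\<gamma> * Bl"
    and "T 0 = (Q 0)\<^sup>T * W 0" and "S 0 = (V 0)\<^sup>T * U 0"
    and "\<And>j. j \<ge> 1 \<Longrightarrow> U j = At * U (j - 1)"
    and "\<And>j. j \<ge> 1 \<Longrightarrow> V j = At\<^sup>T * V (j - 1)"
    and "\<And>j. j \<ge> 1 \<Longrightarrow> W j = Dt * W (j - 1)"
    and "\<And>j. j \<ge> 1 \<Longrightarrow> Q j = Dt\<^sup>T * Q (j - 1)"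
    and "\<And>j. j \<ge> 1 \<Longrightarrow> Uhat j = block_row U (2 ^ j)"
    and "\<And>j. j \<ge> 1 \<Longrightarrow> Vhat j = block_row V (2 ^ j)"
    and "\<And>j. j \<ge> 1 \<Longrightarrow> What j = block_row W (2 ^ j)"
    and "\<And>j. j \<ge> 1 \<Longrightarrow> Qhat j = block_row Q (2 ^ j)"
    and "\<And>j. j \<ge> 1 \<Longrightarrow> T j = (Qhat j)\<^sup>T * What j"
    and "\<And>j. j \<ge> 1 \<Longrightarrow> S j = (Vhat j)\<^sup>T * Uhat j"
    and "\<And>j. j \<ge> 1 \<Longrightarrow> Y j = four_block_mat
           (0\<^sub>m (2 ^ (j - 1) * m1) (2 ^ (j - 1) * n1)) (Y (j - 1))
           (Y (j - 1)) ((- 2 * \<gamma>) \<cdot>\<^sub>m T (j - 1))"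
    and "\<And>j. j \<ge> 1 \<Longrightarrow> Z j = four_block_mat
           (0\<^sub>m (2 ^ (j - 1) * n1) (2 ^ (j - 1) * m1)) (Z (j - 1))
           (Z (j - 1)) ((- 2 * \<gamma>) \<cdot>\<^sub>m S (j - 1))"
  shows "\<forall>k \<ge> 1.
      invertible_mat (1\<^sub>m (2 ^ k * m1) - Y k * Z k)
    \<and> invertible_mat (1\<^sub>m (2 ^ k * n1) - Z k * Y k)
    \<and> F k = At ^\<^sub>m (2 ^ k)
        - (2 * \<gamma>) \<cdot>\<^sub>m (Uhat k * mat_inv (1\<^sub>m (2 ^ k * m1) - Y k * Z k) * Y k * (Vhat k)\<^sup>T)
    \<and> E k = Dt ^\<^sub>m (2 ^ k)
        - (2 * \<gamma>) \<cdot>\<^sub>m (What k * mat_inv (1\<^sub>m (2 ^ k * n1) - Z k * Y k) * Z k * (Qhat k)\<^sup>T)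
    \<and> H k = (2 * \<gamma>) \<cdot>\<^sub>m (Uhat k * mat_inv (1\<^sub>m (2 ^ k * m1) - Y k * Z k) * (Qhat k)\<^sup>T)
    \<and> G k = (2 * \<gamma>) \<cdot>\<^sub>m (What k * mat_inv (1\<^sub>m (2 ^ k * n1) - Z k * Y k) * (Vhat k)\<^sup>T)"
  proof -
  have A: "A\<gamma> \<in> carrier_mat m m" and D: "D\<gamma> \<in> carrier_mat n n"
    using assms(1,2,12,13) by auto
  note cA = mat_inv_carrier[OF A assms(16)] and cD = mat_inv_carrier[OF D assms(17)]
  have cAt: "At \<in> carrier_mat m m" and cDt: "Dt \<in> carrier_mat n n"
    unfolding assms(30,31) using cA cD by auto
  have B: "B = Bl * Br\<^sup>T" and C: "C = Cl * Cr\<^sup>T"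
    using assms(9,10) by (auto simp: full_rank_factorization_def)
  have U: "U (Suc j) = At * U j" and V: "V (Suc j) = At\<^sup>T * V j"
    and W: "W (Suc j) = Dt * W j" and Q: "Q (Suc j) = Dt\<^sup>T * Q j" for j
    using assms(40-43)[of "Suc j"] by simp_all
  have U0: "U 0 \<in> carrier_mat m m1" and V0: "V 0 \<in> carrier_mat m n1"
    and W0: "W 0 \<in> carrier_mat n n1" and Q0: "Q 0 \<in> carrier_mat n m1"
    unfolding assms(32-35) using cA cD assms(5-8) by auto
  note Udbl = block_row_pow_double[of At m U, OF cAt U0 U]
    and Vdbl = block_row_pow_double[of "At\<^sup>T" m V, OF _ V0 V, simplified, OF cAt]
    and Wdbl = block_row_pow_double[of Dt n W, OF cDt W0 W]
    and Qdbl = block_row_pow_double[of "Dt\<^sup>T" n Q, OF _ Q0 Q, simplified, OF cDt]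
  \<comment> \<open>The hatted sequences are specified only from index 1. Written with
    \<open>block_row\<close>, the formulas for \<open>T\<close> and \<open>S\<close> also cover
    index 0, where the row has \<open>2 ^ 0 = 1\<close> block.\<close>
  have T: "T k = (block_row Q (2 ^ k))\<^sup>T * block_row W (2 ^ k)"
    and S: "S k = (block_row V (2 ^ k))\<^sup>T * block_row U (2 ^ k)" for k
    using assms(38,39) assms(44-49)[of k] by (cases k; simp add: block_row_one[simplified])+
  \<comment> \<open>The induction starts at 0, where the starting values form a stage with one-block
    rows; the first iterate is then an ordinary doubling.\<close>
  have stage: "sda_stage m n (2 ^ k * m1) (2 ^ k * n1) (2 * \<gamma>) (At ^\<^sub>m (2 ^ k)) (Dt ^\<^sub>m (2 ^ k))
      (block_row U (2 ^ k)) (block_row V (2 ^ k)) (block_row W (2 ^ k)) (block_row Q (2 ^ k))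
      (Y k) (Z k) (F k) (E k) (H k) (G k)" for k
  proof (induction k)
    case 0
    have "sda_stage m n m1 n1 (2 * \<gamma>) At Dt (U 0) (V 0) (W 0) (Q 0) (Y 0) (Z 0) (F 0) (E 0) (H 0) (G 0)"
      unfolding assms(20-23,30-37)
      by (rule sda_stage_init[OF A assms(16) D assms(17) assms(5-8) B C assms(14,18,15,19)])
    then show ?case using cAt cDt by (simp add: block_row_one[simplified])
  next
    case (Suc k)
    have two: "(2::nat) ^ Suc k = 2 * 2 ^ k" by simp
    have pow: "P ^\<^sub>m (2 * l) = P ^\<^sub>m l * P ^\<^sub>m l" if "P \<in> carrier_mat r r" for P :: "real mat" and r l
      using pow_mat_add[OF that, of l l] by (simp add: mult_2)
    have Y: "Y (Suc k) = four_block_mat (0\<^sub>m (2 ^ k * m1) (2 ^ k * n1)) (Y k) (Y k)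
        ((- (2 * \<gamma>)) \<cdot>\<^sub>m ((block_row Q (2 ^ k))\<^sup>T * block_row W (2 ^ k)))"
      using assms(50)[of "Suc k"] by (simp add: T)
    have Z: "Z (Suc k) = four_block_mat (0\<^sub>m (2 ^ k * n1) (2 ^ k * m1)) (Z k) (Z k)
        ((- (2 * \<gamma>)) \<cdot>\<^sub>m ((block_row V (2 ^ k))\<^sup>T * block_row U (2 ^ k)))"
      using assms(51)[of "Suc k"] by (simp add: S)
    have dims: "2 ^ Suc k * m1 = 2 ^ k * m1 + 2 ^ k * m1" "2 ^ Suc k * n1 = 2 ^ k * n1 + 2 ^ k * n1"
      by simp_all
    \<comment> \<open>\<open>step\<close> expects sizes as sums, while powers and block rows double
      through the exponent \<open>2 * 2 ^ k\<close>; hence \<open>dims\<close> rewrites the sizes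
      before \<open>two\<close> rewrites the remaining exponents.\<close>
    show ?case
      unfolding dims unfolding two Udbl Vdbl Wdbl Qdbl pow[OF cAt] pow[OF cDt] Y Z assms(26-29)
        transpose_pow_mat[OF cAt] transpose_pow_mat[OF cDt]
      by (rule sda_stage.step[OF Suc assms(24,25)])
  qed
  show ?thesis
  proof (intro allI impI)
    fix k :: nat assume k: "k \<ge> 1"
    interpret sda_stage m n "2 ^ k * m1" "2 ^ k * n1" "2 * \<gamma>" "At ^\<^sub>m (2 ^ k)" "Dt ^\<^sub>m (2 ^ k)"
      "block_row U (2 ^ k)" "block_row V (2 ^ k)" "block_row W (2 ^ k)" "block_row Q (2 ^ k)"
      "Y k" "Z k" "F k" "E k" "H k" "G k"
      by (rule stage)
    \<comment> \<open>The formulas for \<open>E\<close> and \<open>G\<close> are those for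
      \<open>F\<close> and \<open>H\<close> read in the dual stage, and likewise the invertibility
      of \<open>I - Z Y\<close>.\<close>
    note D = sda_stage.closed_forms[OF dual] sda_stage.invertible_YZ[OF dual]
    show "invertible_mat (1\<^sub>m (2 ^ k * m1) - Y k * Z k)
      \<and> invertible_mat (1\<^sub>m (2 ^ k * n1) - Z k * Y k)
      \<and> F k = At ^\<^sub>m (2 ^ k)
          - (2 * \<gamma>) \<cdot>\<^sub>m (Uhat k * mat_inv (1\<^sub>m (2 ^ k * m1) - Y k * Z k) * Y k * (Vhat k)\<^sup>T)
      \<and> E k = Dt ^\<^sub>m (2 ^ k)
          - (2 * \<gamma>) \<cdot>\<^sub>m (What k * mat_inv (1\<^sub>m (2 ^ k * n1) - Z k * Y k) * Z k * (Qhat k)\<^sup>T)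
      \<and> H k = (2 * \<gamma>) \<cdot>\<^sub>m (Uhat k * mat_inv (1\<^sub>m (2 ^ k * m1) - Y k * Z k) * (Qhat k)\<^sup>T)
      \<and> G k = (2 * \<gamma>) \<cdot>\<^sub>m (What k * mat_inv (1\<^sub>m (2 ^ k * n1) - Z k * Y k) * (Vhat k)\<^sup>T)"
      unfolding assms(44-47)[OF k]
      using invertible_YZ D(3) closed_forms(1) D(1) closed_forms(2) D(2) by (intro conjI)
  qed
qed

end
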